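(* Let $f=(f_1,\ldots,f_m)$ with $f_i\in\mathbb{Q}[x_1,\ldots,x_n]$, $\mathcal{I}=\langle f_1,\ldots,f_m\rangle\subset\mathbb{Q}[x_1,\ldots,x_n]$, $g\in\mathbb{Q}[x_1,\ldots,x_n]$, and let $\mathcal{B}=\{x^{\alpha_1},\ldots,x^{\alpha_k}\}$ be a set of $k$ monomials connected to $1$ with $|\mathcal{B}^+|=l$. Let $H_1^+\in\mathbb{Q}^{l\times l}$ be a matrix with rows and columns indexed by the elements of $\mathcal{B}^+$. If $k\ge\dim_{\mathbb{Q}}\mathbb{Q}[x_1,\ldots,x_n]/\mathcal{I}$ and the Hermite Matrix Certification algorithm described in the context, with input $f,g,\mathcal{B},H_1^+$, does not return Fail, then $\mathcal{I}$ is radical, $\mathcal{B}$ is a basis for $\mathbb{Q}[x_1,\ldots,x_n]/\mathcal{I}$, and the output $H_1,H_g$ satisfies $$H_1=H_1^{\mathcal{B}}(\mathcal{I})\quad\text{and}\quad H_g=H_g^{\mathcal{B}}(\mathcal{I}).$$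
   Context: Extension: $\mathcal{B}^+:=\mathcal{B}\cup\bigcup_{i=1}^n x_i\mathcal{B}$. Connected to 1: a finite set $\mathcal{B}$ of monomials is connected to $1$ if $1\in\mathcal{B}$ and every $b\in\mathrm{span}(\mathcal{B})$ can be written as $b=c+\sum_{i=1}^n x_ib_i$ with $c$ a constant and $b_i\in\mathrm{span}(\mathcal{B})$, each $b_i$ being zero or satisfying $\deg b_i<\deg b$. Hermite matrix: for a zero-dimensional ideal $\mathcal{I}$ with monomial basis $\mathcal{B}=\{x^{\alpha_1},\ldots,x^{\alpha_k}\}$ of $A=\mathbb{Q}[x_1,\ldots,x_n]/\mathcal{I}$ and a polynomial $g$, $H_g^{\mathcal{B}}(\mathcal{I}):=\left[\mathrm{Tr}(\mu_{g\,x^{\alpha_i+\alpha_j}})\right]_{i,j=1}^k$, where $\mu_h:A\to A$, $p\mapsto hp$ is multiplication by $h$. Hermite Matrix Certification algorithm. Input: $f$, $g$, $\mathcal{B}$, $H_1^+$ as in the statement. Step 1. Let $H_1$ be the $k\times k$ submatrix of $H_1^+$ with rows and columns indexed by $\mathcal{B}$; for $s=1,\ldots,n$ let $H_1^{x_s}$ be the $k\times k$ submatrix of $H_1^+$ with rows indexed by $\mathcal{B}$ and columns indexed by $x_s\mathcal{B}$ (the $i$-th column being that of $x_sx^{\alpha_i}$). Step 2. If $\mathrm{rank}\,H_1=\mathrm{rank}\,H_1^+=k$, set $M_s:=H_1^{-1}H_1^{x_s}$ for $s=1,\ldots,n$; else return Fail. Step 3. If for some $s\in\{1,\ldots,n\}$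 and $i,j\in\{1,\ldots,k\}$ we have $x_sx^{\alpha_i}=x^{\alpha_j}$ but the $i$-th column of $M_s$ is not the $j$-th standard unit vector, return Fail. Step 4. Let $c_1,\ldots,c_n$ be either new parameters (indeterminates) or generic elements of $\mathbb{Q}$, and let $p(\lambda)$ be the characteristic polynomial of $\sum_{i=1}^n c_iM_i$. If $\gcd(p(\lambda),p'(\lambda))\ne1$, return Fail. Step 5. If $M_iM_j=M_jM_i$ for all $1\le i<j\le n$ and $f_i(M_1,\ldots,M_n)=0$ for $i=1,\ldots,m$, continue; else return Fail. Step 6. If for some $i,j\in\{1,\ldots,k\}$, $\mathrm{Tr}\big((x^{\alpha_i}x^{\alpha_j})(M_1,\ldots,M_n)\big)\ne[H_1]_{i,j}$, where $(x^{\alpha_i}x^{\alpha_j})(M_1,\ldots,M_n)$ is the evaluation of the monomial $x^{\alpha_i}x^{\alpha_j}$ at the matrices, return Fail. Step 7. Return $H_1$ and $H_g:=H_1\cdot g(M_1,\ldots,M_n)$. *)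

theory Defs
  imports
    "HOL-Library.Poly_Mapping"
    "HOL-Computational_Algebra.Normalized_Fraction"
    "HOL-Algebra.QuotRing"
    "Jordan_Normal_Form.Char_Poly"
    "Jordan_Normal_Form.DL_Rank"
    "Jordan_Normal_Form.Gauss_Jordan_Elimination"
begin

hide_const (open) Multiset.mult Polynomial.smult

text \<open>
  A monomial \<open>x\<^sup>\<alpha>\<close> is represented by its exponent vector \<open>\<alpha>\<close>, so that
  products of monomials are sums of exponent vectors.  The variables are indexed by a finite type
  \<open>'n\<close>, whose linear order is the order of the indices \<open>1, \<dots>, n\<close>.
\<close>

type_synonym 'n mon = "'n \<Rightarrow>\<^sub>0 nat"
type_synonym 'n mpoly = "'n mon \<Rightarrow>\<^sub>0 rat"

text \<open>This instance makes \<open>'n mpoly\<close> an integral domain, so that its field of fractions is available.\<close>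

instance poly_mapping :: (linorder,
    "{ordered_comm_monoid_add, ordered_ab_semigroup_add_imp_le, cancel_comm_monoid_add, linorder}")
    ordered_cancel_comm_monoid_add ..

abbreviation var_mon :: "'n \<Rightarrow> 'n mon" where
  "var_mon s \<equiv> Poly_Mapping.single s 1"

abbreviation Const :: "rat \<Rightarrow> 'n mpoly" where
  "Const c \<equiv> Poly_Mapping.single 0 c"

abbreviation Mon :: "'n mon \<Rightarrow> 'n mpoly" where
  "Mon \<alpha> \<equiv> Poly_Mapping.single \<alpha> 1"

abbreviation Var :: "'n \<Rightarrow> 'n mpoly" where
  "Var s \<equiv> Mon (var_mon s)"

definition mon_degree :: "'n::finite mon \<Rightarrow> nat" where
  "mon_degree \<alpha> = (\<Sum>s\<in>UNIV. Poly_Mapping.lookup \<alpha> s)"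

definition total_degree :: "'n::finite mpoly \<Rightarrow> nat" where
  "total_degree p = (if p = 0 then 0 else Max (mon_degree ` Poly_Mapping.keys p))"


subsection \<open>Sets of monomials\<close>

definition extension :: "'n mon set \<Rightarrow> 'n mon set" where
  "extension B = B \<union> (\<Union>s. (\<lambda>\<alpha>. var_mon s + \<alpha>) ` B)"

definition mon_span :: "'n mon set \<Rightarrow> 'n mpoly set" where
  "mon_span B = {\<Sum>\<alpha>\<in>B. Const (c \<alpha>) * Mon \<alpha> | c. True}"

definition connected_to_one :: "'n::finite mon set \<Rightarrow> bool" where
  "connected_to_one B \<longleftrightarrow> finite B \<and> 0 \<in> B \<and>
     (\<forall>b\<in>mon_span B. \<exists>c q. b = Const c + (\<Sum>s\<in>UNIV. Var s * q s) \<and>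
        (\<forall>s. q s \<in> mon_span B \<and> (q s = 0 \<or> total_degree (q s) < total_degree b)))"


subsection \<open>The quotient algebra, traces and Hermite matrices\<close>

definition poly_ideal :: "'n mpoly list \<Rightarrow> 'n mpoly set" where
  "poly_ideal fs = genideal class_ring (set fs)"

definition radical :: "'n mpoly set \<Rightarrow> 'n mpoly set" where
  "radical I = {p. \<exists>r>0. p ^ r \<in> I}"

definition residue_class :: "'n mpoly set \<Rightarrow> 'n mpoly \<Rightarrow> 'n mpoly set" where
  "residue_class I p = I +>\<^bsub>class_ring\<^esub> p"

text \<open>The quotient ring modulo \<open>I\<close>, regarded as a vector space over \<open>class_ring :: rat ring\<close>.\<close>

definition quot_alg :: "'n mpoly set \<Rightarrow> (rat, 'n mpoly set) module" where
  "quot_alg I = (let A = class_ring Quot I in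
     \<lparr>carrier = carrier A, mult = mult A, one = one A, zero = zero A, add = add A,
      smult = (\<lambda>c u. residue_class I (Const c) \<otimes>\<^bsub>A\<^esub> u)\<rparr>)"

text \<open>
  The trace of an endomorphism \<open>T\<close> of a finite-dimensional rational vector space \<open>V\<close>: the sum of
  the diagonal entries of the matrix of \<open>T\<close> in any basis \<open>S\<close>.  Here \<open>a v w\<close> is the coefficient of
  \<open>w\<close> in \<open>T v\<close>; the value does not depend on the basis, which justifies the definite description.
\<close>

definition endo_trace :: "(rat, 'v) module \<Rightarrow> ('v \<Rightarrow> 'v) \<Rightarrow> rat" where
  "endo_trace V T = (THE t. \<exists>S a. finite S \<and> vectorspace.basis class_ring V S \<and>
     (\<forall>v\<in>S. T v = LinearCombinations.module.lincomb V (a v) S) \<and> t = (\<Sum>v\<in>S. a v v))"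

definition mult_map :: "'n mpoly set \<Rightarrow> 'n mpoly \<Rightarrow> 'n mpoly set \<Rightarrow> 'n mpoly set" where
  "mult_map I h = (\<lambda>u. residue_class I h \<otimes>\<^bsub>quot_alg I\<^esub> u)"

definition hermite_matrix :: "'n mpoly set \<Rightarrow> 'n mon list \<Rightarrow> 'n mpoly \<Rightarrow> rat mat" where
  "hermite_matrix I bs g = mat (length bs) (length bs)
     (\<lambda>(i, j). endo_trace (quot_alg I) (mult_map I (g * Mon (bs ! i + bs ! j))))"


subsection \<open>Evaluation of polynomials at matrices\<close>

definition mat_trace :: "'a::comm_monoid_add mat \<Rightarrow> 'a" where
  "mat_trace A = (\<Sum>i<dim_row A. A $$ (i, i))"

text \<open>
  The factors are multiplied in increasing order of the variables; the algorithm
  evaluates at commuting matrices only, where the order is irrelevant.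
\<close>

definition eval_mon :: "nat \<Rightarrow> ('n::{finite,linorder} \<Rightarrow> rat mat) \<Rightarrow> 'n mon \<Rightarrow> rat mat" where
  "eval_mon k M \<alpha> = foldr (\<lambda>s P. (M s ^\<^sub>m Poly_Mapping.lookup \<alpha> s) * P)
     (sorted_list_of_set UNIV) (1\<^sub>m k)"

definition eval_poly :: "nat \<Rightarrow> ('n::{finite,linorder} \<Rightarrow> rat mat) \<Rightarrow> 'n mpoly \<Rightarrow> rat mat" where
  "eval_poly k M p = mat k k
     (\<lambda>ij. \<Sum>\<alpha>\<in>Poly_Mapping.keys p. Poly_Mapping.lookup p \<alpha> * eval_mon k M \<alpha> $$ ij)"


subsection \<open>The certification algorithm\<close>

text \<open>
  The coefficients of the linear combination whose characteristic polynomial is tested for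
  square-freeness: either indeterminates, in which case the characteristic polynomial has
  coefficients in the field of fractions of \<open>'n mpoly\<close>, or rational numbers.  No genericity of
  the latter is required: an unlucky choice can only make the test fail.
\<close>

datatype 'n coeff_choice = Indeterminates | Rationals "'n \<Rightarrow> rat"

text \<open>
  \<open>coprime\<close> says that the gcd is \<open>1\<close>; the library has no \<open>gcd\<close> on \<open>'a fract poly\<close>.
\<close>

definition separating_test ::
  "'n::{finite,linorder} coeff_choice \<Rightarrow> nat \<Rightarrow> ('n \<Rightarrow> rat mat) \<Rightarrow> bool" where
  "separating_test ch k M = (case ch of
     Indeterminates \<Rightarrow>
       (let p = char_poly (mat k k (\<lambda>ij. \<Sum>s\<in>UNIV. to_fract (Var s) * to_fract (Const (M s $$ ij))))
        in coprime p (pderiv p))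
   | Rationals c \<Rightarrow>
       (let p = char_poly (mat k k (\<lambda>ij. \<Sum>s\<in>UNIV. c s * M s $$ ij))
        in coprime p (pderiv p)))"

definition index_in :: "'a list \<Rightarrow> 'a \<Rightarrow> nat" where
  "index_in xs x = (THE i. i < length xs \<and> xs ! i = x)"

text \<open>
  If the rows and columns of \<open>H\<close> are indexed by the entries of the list \<open>es\<close>, this is the
  submatrix with rows indexed by \<open>rs\<close> and columns indexed by \<open>cs\<close>, in the order of these lists.
\<close>

definition submatrix_at :: "'a list \<Rightarrow> rat mat \<Rightarrow> 'a list \<Rightarrow> 'a list \<Rightarrow> rat mat" where
  "submatrix_at es H rs cs = mat (length rs) (length cs)
     (\<lambda>(i, j). H $$ (index_in es (rs ! i), index_in es (cs ! j)))"

text \<open>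
  Arguments: the choice of the coefficients in the square-freeness test, the polynomials \<open>fs\<close> and
  \<open>g\<close>, the list \<open>bs\<close> of the monomials in \<open>B\<close>, a list \<open>es\<close> of the monomials in \<open>extension B\<close>, and
  the matrix \<open>H\<close> with rows and columns indexed by \<open>es\<close>.  The result \<open>None\<close> stands for Fail.
\<close>

definition hermite_certification ::
  "'n::{finite,linorder} coeff_choice \<Rightarrow> 'n mpoly list \<Rightarrow> 'n mpoly \<Rightarrow> 'n mon list \<Rightarrow>
   'n mon list \<Rightarrow> rat mat \<Rightarrow> (rat mat \<times> rat mat) option" where
  "hermite_certification ch fs g bs es H =
    (let k = length bs;
         H1 = submatrix_at es H bs bs;
         Hx = (\<lambda>s. submatrix_at es H bs (map (\<lambda>\<alpha>. var_mon s + \<alpha>) bs));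
         M = (\<lambda>s. the (mat_inverse H1) * Hx s)
     in
     if \<not> (vec_space.rank k H1 = k \<and> vec_space.rank (length es) H = k) then None
     else if \<exists>s. \<exists>i<k. \<exists>j<k. var_mon s + bs ! i = bs ! j \<and> col (M s) i \<noteq> unit_vec k j then None
     else if \<not> separating_test ch k M then None
     else if \<not> ((\<forall>s t. s < t \<longrightarrow> M s * M t = M t * M s) \<and>
                (\<forall>f\<in>set fs. eval_poly k M f = 0\<^sub>m k k)) then None
     else if \<exists>i<k. \<exists>j<k. mat_trace (eval_mon k M (bs ! i + bs ! j)) \<noteq> H1 $$ (i, j) then None
     else Some (H1, H1 * eval_poly k M g))"

end

theory Submission
  imports Defs "Jordan_Normal_Form.Schur_Decomposition"
begin

text \<open>
  Evaluation \<open>p \<mapsto> p(M)\<close> at the commuting matrices is a ring homomorphism that kills the ideal.  By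
  connectedness and Step 3, the monomials of \<open>B\<close>, evaluated at \<open>M\<close>, map the unit vector \<open>e\<close>
  belonging to the monomial \<open>1\<close> to the standard basis; hence \<open>p \<mapsto> p(M) e\<close> is onto, the monomials of
  \<open>B\<close> are independent modulo the ideal, and by the dimension bound they form a basis in which
  multiplication by \<open>h\<close> has the matrix \<open>h(M)\<close>.  Steps 6 and 7 then identify the Hermite matrices.
  A nilpotent element is orthogonal to everything under the trace form, whose matrix \<open>H\<^sub>1\<close> is
  invertible, so the ideal is radical.
\<close>

subsection \<open>Traces and evaluation at commuting matrices\<close>

lemma mat_trace_mult_comm:
  fixes A B :: "'a::comm_semiring_0 mat"
  assumes "A \<in> carrier_mat n m" and "B \<in> carrier_mat m n"
  shows "mat_trace (A * B) = mat_trace (B * A)"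
proof -
  have "mat_trace (A * B) = (\<Sum>i<n. \<Sum>j<m. A $$ (i, j) * B $$ (j, i))"
    using assms by (auto simp: mat_trace_def scalar_prod_def lessThan_atLeast0 intro!: sum.cong)
  also have "\<dots> = (\<Sum>j<m. \<Sum>i<n. B $$ (j, i) * A $$ (i, j))"
    by (subst sum.swap) (simp add: mult.commute)
  also have "\<dots> = mat_trace (B * A)"
    using assms by (auto simp: mat_trace_def scalar_prod_def lessThan_atLeast0 intro!: sum.cong)
  finally show ?thesis .
qed

lemma mat_trace_similar:
  fixes A B :: "'a::comm_semiring_1 mat"
  assumes "similar_mat_wit A B P Q"
  shows "mat_trace A = mat_trace B"
proof -
  define n where "n = dim_row A"
  note w = similar_mat_witD[OF n_def assms]
  have "mat_trace A = mat_trace (P * (B * Q))"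
    using w(5-7) by (subst w(3)) (simp add: assoc_mult_mat[of P n n B n Q n])
  also have "\<dots> = mat_trace ((B * Q) * P)"
    by (rule mat_trace_mult_comm[of _ n n]) (use w(5-7) in auto)
  also have "(B * Q) * P = B"
    using w(2,5-7) by (simp add: assoc_mult_mat[of B n n Q n P n])
  finally show ?thesis .
qed

lemma eigenvalue_nilpotent_mat:
  fixes A :: "'a::field mat"
  assumes A: "A \<in> carrier_mat n n" and nil: "A ^\<^sub>m r = 0\<^sub>m n n" and ev: "eigenvalue A e"
  shows "e = 0"
proof -
  from ev obtain v where v: "eigenvector A v e" unfolding eigenvalue_def by blast
  then have vn: "v \<in> carrier_vec n" "v \<noteq> 0\<^sub>v n" using A unfolding eigenvector_def by auto
  have "0\<^sub>m n n *\<^sub>v v = 0\<^sub>v n"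
    using vn(1) by (intro eq_vecI) auto
  then have z: "e ^ r \<cdot>\<^sub>v v = 0\<^sub>v n"
    using eigenvector_pow[OF A v, of r] nil by simp
  obtain i where i: "i < n" "v $ i \<noteq> 0"
    using vn by (metis carrier_vecD eq_vecI index_zero_vec)
  have "e ^ r * v $ i = 0"
    using arg_cong[OF z, of "\<lambda>w. w $ i"] i(1) vn(1) by simp
  with i(2) show "e = 0" by simp
qed

text \<open>Over the complex numbers the characteristic polynomial splits. Its roots are
  eigenvalues, hence 0 by nilpotency, and they form the diagonal of a similar Schur form.\<close>

lemma mat_trace_nilpotent_complex:
  fixes A :: "complex mat"
  assumes A: "A \<in> carrier_mat n n" and nil: "A ^\<^sub>m r = 0\<^sub>m n n"
  shows "mat_trace A = 0"
proof -
  obtain es where es: "char_poly A = (\<Prod>e\<leftarrow>es. [:- e, 1:])"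
    using char_poly_factorized[OF A] by blast
  have es0: "e = 0" if "e \<in> set es" for e
  proof -
    have "poly (char_poly A) e = 0"
      using that unfolding es by (auto simp: poly_prod_list prod_list_zero_iff)
    then show ?thesis
      using eigenvalue_nilpotent_mat[OF A nil] eigenvalue_root_char_poly[OF A] by blast
  qed
  obtain B P Q where "schur_decomposition A es = (B, P, Q)"
    by (metis prod_cases3)
  from schur_decomposition[OF A es this]
  have w: "similar_mat_wit A B P Q" and d: "diag_mat B = es" by auto
  have "B $$ (i, i) = 0" if "i < dim_row B" for i
  proof (rule es0)
    show "B $$ (i, i) \<in> set es" using that unfolding d[symmetric] diag_mat_def by auto
  qed
  then show ?thesis unfolding mat_trace_similar[OF w] by (simp add: mat_trace_def)
qed

text \<open>A characteristic polynomial need not split over the rationals, so the entries are first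
  embedded into the complex numbers.\<close>

lemma mat_trace_nilpotent:
  fixes A :: "rat mat"
  assumes A: "A \<in> carrier_mat n n" and nil: "A ^\<^sub>m r = 0\<^sub>m n n"
  shows "mat_trace A = 0"
proof -
  let ?A = "map_mat of_rat A :: complex mat"
  have "?A ^\<^sub>m r = 0\<^sub>m n n"
    by (subst of_rat_hom.mat_hom_pow[OF A, symmetric]) (auto simp: nil intro!: eq_matI)
  then have "mat_trace ?A = 0"
    using A by (intro mat_trace_nilpotent_complex) auto
  moreover have "mat_trace ?A = of_rat (mat_trace A)"
    using A by (auto simp: mat_trace_def of_rat_sum intro!: sum.cong)
  ultimately show ?thesis by simp
qed

section \<open>Evaluation at commuting matrices as a ring homomorphism\<close>

lemma poly_mapping_sum_single:
  "p = (\<Sum>\<alpha>\<in>Poly_Mapping.keys p. Poly_Mapping.single \<alpha> (Poly_Mapping.lookup p \<alpha>))"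
  by (rule poly_mapping_eqI)
    (auto simp: lookup_sum lookup_single when_def in_keys_iff)

lemma pow_mat_commute:
  fixes A B :: "'a::semiring_1 mat"
  assumes A: "A \<in> carrier_mat n n" and B: "B \<in> carrier_mat n n" and AB: "A * B = B * A"
  shows "A ^\<^sub>m i * B = B * A ^\<^sub>m i"
proof (induction i)
  case (Suc i)
  have P: "A ^\<^sub>m i \<in> carrier_mat n n" using A by simp
  have "A ^\<^sub>m Suc i * B = A ^\<^sub>m i * (B * A)"
    using A B P by (simp add: assoc_mult_mat[OF P A B] AB)
  also have "\<dots> = B * A ^\<^sub>m i * A"
    using Suc by (simp add: assoc_mult_mat[OF P B A, symmetric])
  also have "\<dots> = B * A ^\<^sub>m Suc i"
    using A B P by (simp add: assoc_mult_mat[OF B P A])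
  finally show ?case .
qed (use A B in simp)

lemma pow_mat_add:
  fixes A :: "'a::semiring_1 mat"
  assumes A: "A \<in> carrier_mat n n"
  shows "A ^\<^sub>m (i + j) = A ^\<^sub>m i * A ^\<^sub>m j"
proof (induction j)
  case (Suc j)
  have P: "A ^\<^sub>m l \<in> carrier_mat n n" for l using A by simp
  then show ?case using Suc by (simp add: assoc_mult_mat[OF P P A])
qed (use A in simp)

locale commuting_matrices =
  fixes k :: nat and M :: "'n::{finite,linorder} \<Rightarrow> rat mat"
  assumes M_carrier [simp]: "M s \<in> carrier_mat k k"
    and M_commute: "M s * M t = M t * M s"
begin

text \<open>\<open>eval_mon\<close> is the case of the sorted list of all variables; leaving the
  list free permits induction on it.\<close>

definition list_eval :: "'n list \<Rightarrow> 'n mon \<Rightarrow> rat mat" where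
  "list_eval xs \<alpha> = foldr (\<lambda>s P. (M s ^\<^sub>m Poly_Mapping.lookup \<alpha> s) * P) xs (1\<^sub>m k)"

lemma list_eval_simps [simp]:
  "list_eval [] \<alpha> = 1\<^sub>m k"
  "list_eval (s # xs) \<alpha> = (M s ^\<^sub>m Poly_Mapping.lookup \<alpha> s) * list_eval xs \<alpha>"
  by (simp_all add: list_eval_def)

lemma M_pow_carrier [simp]: "M s ^\<^sub>m i \<in> carrier_mat k k"
  using M_carrier[of s] by (rule pow_carrier_mat)

lemma list_eval_carrier [simp]: "list_eval xs \<alpha> \<in> carrier_mat k k"
  by (induction xs) (auto intro!: mult_carrier_mat[of _ k k])

lemma M_pow_commute: "M s ^\<^sub>m i * M t ^\<^sub>m j = M t ^\<^sub>m j * M s ^\<^sub>m i"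
  using pow_mat_commute[OF M_carrier M_pow_carrier
      pow_mat_commute[OF M_carrier M_carrier M_commute, symmetric]] .

lemma M_pow_list_eval_commute:
  "M s ^\<^sub>m i * list_eval xs \<alpha> = list_eval xs \<alpha> * M s ^\<^sub>m i"
proof (induction xs)
  case Nil
  then show ?case by (simp add: right_mult_one_mat[of _ k k] left_mult_one_mat[of _ k k])
next
  case (Cons t xs)
  let ?A = "M s ^\<^sub>m i" and ?B = "M t ^\<^sub>m Poly_Mapping.lookup \<alpha> t" and ?C = "list_eval xs \<alpha>"
  have "?A * (?B * ?C) = ?B * (?A * ?C)"
    by (simp add: assoc_mult_mat[of _ k k _ k _ k, symmetric] M_pow_commute[of s i t])
  also have "\<dots> = (?B * ?C) * ?A"
    by (simp add: assoc_mult_mat[of _ k k _ k _ k] Cons)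
  finally show ?case by simp
qed

text \<open>In the induction step the second power of \<open>M s\<close> is moved to the left past
  the evaluation of \<alpha> at the remaining variables, which is where commutation enters.\<close>

lemma list_eval_add: "list_eval xs (\<alpha> + \<beta>) = list_eval xs \<alpha> * list_eval xs \<beta>"
proof (induction xs)
  case (Cons s xs)
  let ?A = "M s ^\<^sub>m Poly_Mapping.lookup \<alpha> s" and ?B = "M s ^\<^sub>m Poly_Mapping.lookup \<beta> s"
    and ?C = "list_eval xs \<alpha>" and ?D = "list_eval xs \<beta>"
  have "list_eval (s # xs) (\<alpha> + \<beta>) = (?A * ?B) * (?C * ?D)"
    using Cons by (simp add: lookup_add pow_mat_add[OF M_carrier])
  also have "\<dots> = ?A * ((?B * ?C) * ?D)"
    by (simp add: assoc_mult_mat[of _ k k _ k _ k] mult_carrier_mat[of _ k k _ k])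
  also have "\<dots> = ?A * ((?C * ?B) * ?D)"
    by (simp add: M_pow_list_eval_commute)
  also have "\<dots> = (?A * ?C) * (?B * ?D)"
    by (simp add: assoc_mult_mat[of _ k k _ k _ k] mult_carrier_mat[of _ k k _ k])
  finally show ?case by simp
qed simp

lemma list_eval_var_mon:
  "distinct xs \<Longrightarrow> list_eval xs (var_mon s) = (if s \<in> set xs then M s else 1\<^sub>m k)"
  using right_mult_one_mat[OF M_carrier[of s]] left_mult_one_mat[OF M_carrier[of s]]
  by (induction xs) (auto simp: lookup_single when_def carrier_matD[OF M_carrier])

lemma eval_mon_carrier [simp]: "eval_mon k M \<alpha> \<in> carrier_mat k k"
  using list_eval_carrier by (simp add: eval_mon_def list_eval_def)

lemma eval_mon_add: "eval_mon k M (\<alpha> + \<beta>) = eval_mon k M \<alpha> * eval_mon k M \<beta>"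
  using list_eval_add by (simp add: eval_mon_def list_eval_def)

lemma eval_mon_zero: "eval_mon k M 0 = 1\<^sub>m k"
proof -
  have "list_eval xs 0 = 1\<^sub>m k" for xs
    by (induction xs) (auto simp: carrier_matD[OF M_carrier])
  then show ?thesis by (simp add: eval_mon_def list_eval_def)
qed

lemma eval_mon_var_mon: "eval_mon k M (var_mon s) = M s"
  using list_eval_var_mon[of "sorted_list_of_set UNIV" s] by (simp add: eval_mon_def list_eval_def)

abbreviation ev :: "'n mpoly \<Rightarrow> rat mat" where "ev \<equiv> eval_poly k M"

lemma ev_carrier [simp]: "ev p \<in> carrier_mat k k"
  by (simp add: eval_poly_def)

lemma ev_dim [simp]: "dim_row (ev p) = k" "dim_col (ev p) = k"
  by (simp_all add: eval_poly_def)

text \<open>Cancellation can remove keys from \<open>p + q\<close>; enlarging the index set lets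
  \<open>p\<close>, \<open>q\<close> and \<open>p + q\<close> be summed over the same
  monomials.\<close>

lemma ev_index_superset:
  assumes "finite K" "Poly_Mapping.keys p \<subseteq> K" "i < k" "j < k"
  shows "ev p $$ (i, j) = (\<Sum>\<alpha>\<in>K. Poly_Mapping.lookup p \<alpha> * eval_mon k M \<alpha> $$ (i, j))"
  unfolding eval_poly_def using assms
  by (auto intro!: sum.mono_neutral_left simp: in_keys_iff)

lemma ev_single:
  assumes "i < k" "j < k"
  shows "ev (Poly_Mapping.single \<alpha> c) $$ (i, j) = c * eval_mon k M \<alpha> $$ (i, j)"
  using assms by (subst ev_index_superset[of "{\<alpha>}"]) auto

lemma ev_Mon: "ev (Mon \<alpha>) = eval_mon k M \<alpha>"
  by (rule eq_matI) (auto simp: ev_single carrier_matD[OF eval_mon_carrier])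

lemma ev_one: "ev 1 = 1\<^sub>m k"
  using ev_Mon[of 0] by (simp add: eval_mon_zero)

lemma ev_zero: "ev 0 = 0\<^sub>m k k"
  by (rule eq_matI) (auto simp: eval_poly_def)

lemma ev_add: "ev (p + q) = ev p + ev q"
proof (rule eq_matI)
  fix i j assume "i < dim_row (ev p + ev q)" "j < dim_col (ev p + ev q)"
  then have ij: "i < k" "j < k" by auto
  let ?K = "Poly_Mapping.keys p \<union> Poly_Mapping.keys q"
  show "ev (p + q) $$ (i, j) = (ev p + ev q) $$ (i, j)"
    using ij keys_add[of p q]
    by (simp add: ev_index_superset[of ?K] lookup_add algebra_simps sum.distrib)
qed auto

lemma ev_sum:
  assumes "i < k" "j < k"
  shows "ev (sum f A) $$ (i, j) = (\<Sum>a\<in>A. ev (f a) $$ (i, j))"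
  using assms by (induction A rule: infinite_finite_induct) (auto simp: ev_zero ev_add)

text \<open>Both factors are expanded into monomials, where \<open>eval_mon_add\<close> applies.
  Moving the inner index of the matrix product to the outermost sum then separates the two
  evaluations.\<close>

lemma ev_mult: "ev (p * q) = ev p * ev q"
proof (rule eq_matI)
  fix i j assume "i < dim_row (ev p * ev q)" "j < dim_col (ev p * ev q)"
  then have ij: "i < k" "j < k" by auto
  let ?P = "Poly_Mapping.keys p" and ?Q = "Poly_Mapping.keys q"
  let ?p = "Poly_Mapping.lookup p" and ?q = "Poly_Mapping.lookup q" and ?E = "eval_mon k M"
  have "p * q = (\<Sum>\<alpha>\<in>?P. \<Sum>\<beta>\<in>?Q. Poly_Mapping.single (\<alpha> + \<beta>) (?p \<alpha> * ?q \<beta>))"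
    by (subst (1) poly_mapping_sum_single[of p], subst (1) poly_mapping_sum_single[of q])
      (simp add: sum_product mult_single)
  then have "ev (p * q) $$ (i, j) =
      (\<Sum>\<alpha>\<in>?P. \<Sum>\<beta>\<in>?Q. ?p \<alpha> * ?q \<beta> * (?E \<alpha> * ?E \<beta>) $$ (i, j))"
    using ij by (simp add: ev_sum ev_single eval_mon_add)
  also have "\<dots> = (\<Sum>\<alpha>\<in>?P. \<Sum>\<beta>\<in>?Q. \<Sum>l<k. (?p \<alpha> * ?E \<alpha> $$ (i, l)) * (?q \<beta> * ?E \<beta> $$ (l, j)))"
    using ij carrier_matD[OF eval_mon_carrier]
    by (intro sum.cong refl)
      (auto simp: scalar_prod_def lessThan_atLeast0 sum_distrib_left mult_ac intro!: sum.cong)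
  also have "\<dots> = (\<Sum>\<alpha>\<in>?P. \<Sum>l<k. \<Sum>\<beta>\<in>?Q. (?p \<alpha> * ?E \<alpha> $$ (i, l)) * (?q \<beta> * ?E \<beta> $$ (l, j)))"
    by (intro sum.cong refl sum.swap)
  also have "\<dots> = (\<Sum>l<k. \<Sum>\<alpha>\<in>?P. \<Sum>\<beta>\<in>?Q. (?p \<alpha> * ?E \<alpha> $$ (i, l)) * (?q \<beta> * ?E \<beta> $$ (l, j)))"
    by (rule sum.swap)
  also have "\<dots> = (\<Sum>l<k. ev p $$ (i, l) * ev q $$ (l, j))"
    using ij by (auto simp: eval_poly_def sum_product intro!: sum.cong)
  also have "\<dots> = (ev p * ev q) $$ (i, j)"
    using ij by (auto simp: scalar_prod_def lessThan_atLeast0 intro!: sum.cong)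
  finally show "ev (p * q) $$ (i, j) = (ev p * ev q) $$ (i, j)" .
qed auto

lemma ev_power: "ev (p ^ r) = ev p ^\<^sub>m r"
  by (induction r) (simp_all only: power_0 power_Suc2 ev_one ev_mult pow_mat.simps ev_dim)

lemma ev_uminus: "ev (- p) = - ev p"
  by (rule eq_matI) (auto simp: eval_poly_def sum_negf)

end

subsection \<open>Traces in coordinates\<close>

text \<open>The functionals \<open>coord _ i\<close> are dual to the vectors \<open>b i\<close>.
  Spanning is not assumed: it follows in \<open>b_basis\<close> from independence and a bound on the
  dimension.\<close>

locale coordinates = vectorspace "class_ring :: rat ring" V
  for V :: "(rat, 'v) module" +
  fixes k :: nat and coord :: "'v \<Rightarrow> nat \<Rightarrow> rat" and b :: "nat \<Rightarrow> 'v"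
  assumes coord_add: "\<lbrakk>u \<in> carrier V; v \<in> carrier V; i < k\<rbrakk> \<Longrightarrow> coord (u \<oplus>\<^bsub>V\<^esub> v) i = coord u i + coord v i"
    and coord_smult: "\<lbrakk>v \<in> carrier V; i < k\<rbrakk> \<Longrightarrow> coord (c \<odot>\<^bsub>V\<^esub> v) i = c * coord v i"
    and b_closed: "i < k \<Longrightarrow> b i \<in> carrier V"
    and coord_b: "\<lbrakk>i < k; j < k\<rbrakk> \<Longrightarrow> coord (b j) i = (if i = j then 1 else 0)"
begin

lemma coord_zero: "i < k \<Longrightarrow> coord \<zero>\<^bsub>V\<^esub> i = 0"
  using coord_add[of "\<zero>\<^bsub>V\<^esub>" "\<zero>\<^bsub>V\<^esub>" i] by simp

lemma coord_minus:
  assumes "u \<in> carrier V" "v \<in> carrier V" "i < k"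
  shows "coord (u \<ominus>\<^bsub>V\<^esub> v) i = coord u i - coord v i"
proof -
  have "coord (\<ominus>\<^bsub>V\<^esub> v) i = - coord v i"
    using assms coord_add[of v "\<ominus>\<^bsub>V\<^esub> v" i] by (simp add: M.r_neg coord_zero)
  then show ?thesis using assms by (simp add: a_minus_def coord_add)
qed

lemma coord_lincomb:
  assumes "finite S" "S \<subseteq> carrier V" "i < k"
  shows "coord (lincomb a S) i = (\<Sum>v\<in>S. a v * coord v i)"
  using assms(1,2)
proof (induction S rule: finite_induct)
  case empty
  then show ?case using assms(3) by (simp add: lincomb_def coord_zero)
next
  case (insert v S)
  have "lincomb a (insert v S) = a v \<odot>\<^bsub>V\<^esub> v \<oplus>\<^bsub>V\<^esub> lincomb a S"
    using insert lincomb_insert[of S a v] by simp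
  moreover have "lincomb a S \<in> carrier V" using insert by (intro lincomb_closed) auto
  ultimately show ?case using insert assms(3) by (simp add: coord_add coord_smult)
qed

lemma b_inj: "inj_on b {..<k}"
  by (rule inj_onI) (metis coord_b lessThan_iff zero_neq_one)

lemma coord_lincomb_b:
  assumes "i < k"
  shows "coord (lincomb a (b ` {..<k})) i = a (b i)"
proof -
  have "coord (lincomb a (b ` {..<k})) i = (\<Sum>j<k. a (b j) * coord (b j) i)"
    using assms b_closed by (subst coord_lincomb) (auto simp: sum.reindex[OF b_inj])
  also have "\<dots> = (\<Sum>j<k. if j = i then a (b j) else 0)"
    using assms by (intro sum.cong) (auto simp: coord_b)
  finally show ?thesis using assms by simp
qed

lemma b_lin_indpt: "lin_indpt (b ` {..<k})"
proof (rule finite_lin_indpt2)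
  show "b ` {..<k} \<subseteq> carrier V" using b_closed by auto
  fix a assume "lincomb a (b ` {..<k}) = \<zero>\<^bsub>V\<^esub>"
  then show "\<forall>v\<in>b ` {..<k}. a v = \<zero>\<^bsub>class_ring\<^esub>"
    using coord_lincomb_b[of _ a] coord_zero by auto
qed simp

lemma b_basis:
  assumes "fin_dim" "dim \<le> k"
  shows "basis (b ` {..<k})"
  using assms b_closed b_lin_indpt by (intro dim_li_is_basis) (auto simp: card_image b_inj)

text \<open>The difference of the two vectors is a combination of the \<open>b i\<close>. By
  \<open>coord_lincomb_b\<close> its coefficients are its coordinates, and these vanish.\<close>

lemma coord_eqI:
  assumes B: "basis (b ` {..<k})" and u: "u \<in> carrier V" and v: "v \<in> carrier V"
    and eq: "\<And>i. i < k \<Longrightarrow> coord u i = coord v i"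
  shows "u = v"
proof -
  have "u \<ominus>\<^bsub>V\<^esub> v \<in> span (b ` {..<k})" using B u v unfolding basis_def by simp
  then obtain a where a: "lincomb a (b ` {..<k}) = u \<ominus>\<^bsub>V\<^esub> v"
    using finite_in_span[of "b ` {..<k}"] b_closed by auto
  have a0: "a w = 0" if "w \<in> b ` {..<k}" for w
    using that coord_lincomb_b[of _ a] eq u v by (auto simp: a coord_minus)
  have "lincomb a (b ` {..<k}) = lincomb (\<lambda>_. 0) (b ` {..<k})"
    using a0 b_closed by (intro lincomb_cong) auto
  also have "\<dots> = \<zero>\<^bsub>V\<^esub>"
    using b_closed unfolding lincomb_def
    by (intro M.finsum_all0) (use smult_l_null in auto)
  finally show ?thesis using a u v by simp
qed

text \<open>
  If \<open>d i\<close> are the coefficients of \<open>b i\<close> in the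
  basis \<open>S\<close>, then \<open>d\<close> and the coordinates of the elements of \<open>S\<close> are mutually inverse matrices.
\<close>

lemma trace_basis_independent:
  assumes B: "basis (b ` {..<k})"
    and T: "\<And>v i. \<lbrakk>v \<in> carrier V; i < k\<rbrakk> \<Longrightarrow> coord (T v) i = (\<Sum>j<k. N i j * coord v j)"
    and S: "finite S" "basis S" and a: "\<And>v. v \<in> S \<Longrightarrow> T v = lincomb (a v) S"
  shows "(\<Sum>v\<in>S. a v v) = (\<Sum>i<k. N i i)"
proof -
  have SV: "S \<subseteq> carrier V" and indep: "lin_indpt S" and gen: "span S = carrier V"
    using S unfolding basis_def by auto
  have "\<exists>a. lincomb a S = b i" if "i < k" for i
    using finite_in_span[OF S(1) SV, of "b i"] b_closed[OF that] gen by auto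
  then obtain d where d: "\<And>i. i < k \<Longrightarrow> lincomb (d i) S = b i" by metis
  have d1: "(\<Sum>v\<in>S. d j v * coord v i) = (if i = j then 1 else 0)" if "i < k" "j < k" for i j
    using coord_lincomb[OF S(1) SV that(1), of "d j"] d that coord_b by simp
  \<comment> \<open>\<open>d1\<close> says that two matrices are inverse on one side; this is the
    other side. The vector \<open>w\<close> and the combination of the \<open>b i\<close> with its
    coordinates agree by \<open>coord_eqI\<close>, so their coefficients in the independent set
    \<open>S\<close> agree too; \<open>c\<close> is the difference of these coefficients.\<close>
  have d2: "(\<Sum>i<k. coord w i * d i v) = (if v = w then 1 else 0)" if "v \<in> S" "w \<in> S" for v w
  proof -
    define c where "c v = (\<Sum>i<k. coord w i * d i v) - (if v = w then 1 else 0)" for v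
    have "lincomb c S = \<zero>\<^bsub>V\<^esub>"
    proof (rule coord_eqI[OF B])
      fix j assume j: "j < k"
      have "coord (lincomb c S) j =
          (\<Sum>v\<in>S. (\<Sum>i<k. coord w i * d i v) * coord v j) - (\<Sum>v\<in>S. if v = w then coord v j else 0)"
        by (auto simp: coord_lincomb[OF S(1) SV j] c_def left_diff_distrib sum_subtractf[symmetric]
            intro!: sum.cong)
      also have "(\<Sum>v\<in>S. (\<Sum>i<k. coord w i * d i v) * coord v j) =
          (\<Sum>i<k. coord w i * (\<Sum>v\<in>S. d i v * coord v j))"
        unfolding sum_distrib_left sum_distrib_right by (subst sum.swap) (simp add: mult_ac)
      also have "\<dots> = (\<Sum>i<k. if i = j then coord w i else 0)"
        using j by (intro sum.cong) (auto simp: d1)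
      finally show "coord (lincomb c S) j = coord \<zero>\<^bsub>V\<^esub> j"
        using j that S(1) by (simp add: coord_zero)
    qed (use SV in auto)
    then have "c v = 0"
      using lin_dep_crit[OF S(1) subset_refl _ that(1), of c] indep by auto
    then show ?thesis by (simp add: c_def)
  qed
  have a': "(\<Sum>w\<in>S. a v w * coord w i) = (\<Sum>j<k. N i j * coord v j)" if "v \<in> S" "i < k" for v i
    using T[of v i] that SV coord_lincomb[OF S(1) SV that(2), of "a v"] a by auto
  \<comment> \<open>This is invariance of the trace under conjugation: \<open>d2\<close> inserts an
    identity matrix, \<open>a'\<close> replaces \<open>a\<close> by \<open>N\<close>, and
    \<open>d1\<close> removes the change of basis.\<close>
  have "(\<Sum>v\<in>S. a v v) = (\<Sum>v\<in>S. \<Sum>w\<in>S. a v w * (\<Sum>i<k. coord w i * d i v))"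
    using S(1) by (intro sum.cong refl) (simp add: d2 if_distrib cong: if_cong)
  also have "\<dots> = (\<Sum>v\<in>S. \<Sum>w\<in>S. \<Sum>i<k. d i v * (a v w * coord w i))"
    by (simp add: sum_distrib_left mult_ac)
  also have "\<dots> = (\<Sum>v\<in>S. \<Sum>i<k. d i v * (\<Sum>w\<in>S. a v w * coord w i))"
    by (subst sum.swap[of _ _ S]) (simp add: sum_distrib_left)
  also have "\<dots> = (\<Sum>v\<in>S. \<Sum>i<k. \<Sum>j<k. N i j * (d i v * coord v j))"
    by (intro sum.cong refl) (simp add: a' sum_distrib_left mult_ac)
  also have "\<dots> = (\<Sum>i<k. \<Sum>j<k. N i j * (\<Sum>v\<in>S. d i v * coord v j))"
    by (subst sum.swap, rule sum.cong[OF refl], subst sum.swap) (simp add: sum_distrib_left)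
  also have "\<dots> = (\<Sum>i<k. \<Sum>j<k. if j = i then N i j else 0)"
    by (intro sum.cong refl) (simp add: d1)
  finally show ?thesis by simp
qed

text \<open>The definite description needs a witness and uniqueness. The basis of the
  \<open>b i\<close> with the coordinates as coefficients is the witness;
  \<open>trace_basis_independent\<close> gives uniqueness.\<close>

lemma endo_trace_eq:
  assumes B: "basis (b ` {..<k})" and TV: "\<And>v. v \<in> carrier V \<Longrightarrow> T v \<in> carrier V"
    and T: "\<And>v i. \<lbrakk>v \<in> carrier V; i < k\<rbrakk> \<Longrightarrow> coord (T v) i = (\<Sum>j<k. N i j * coord v j)"
  shows "endo_trace V T = (\<Sum>i<k. N i i)"
  unfolding endo_trace_def
proof (rule the_equality)
  let ?S = "b ` {..<k}"
  \<comment> \<open>Coefficients of a linear combination are indexed by vectors, so the position of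
    a basis vector is recovered by inverting \<open>b\<close>.\<close>
  define a where "a v w = coord (T v) (the_inv_into {..<k} b w)" for v w
  have "T v = lincomb (a v) ?S" if "v \<in> ?S" for v
  proof (rule coord_eqI[OF B])
    show "T v \<in> carrier V" using that b_closed by (intro TV) auto
    show "lincomb (a v) ?S \<in> carrier V" using b_closed by (intro lincomb_closed) auto
    fix i assume "i < k"
    then show "coord (T v) i = coord (lincomb (a v) ?S) i"
      by (simp add: coord_lincomb_b a_def the_inv_into_f_f[OF b_inj])
  qed
  moreover from this have "(\<Sum>v\<in>?S. a v v) = (\<Sum>i<k. N i i)"
    by (intro trace_basis_independent[OF B T _ B]) auto
  ultimately show "\<exists>S a. finite S \<and> basis S \<and> (\<forall>v\<in>S. T v = lincomb (a v) S)
      \<and> (\<Sum>i<k. N i i) = (\<Sum>v\<in>S. a v v)"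
    using B by (intro exI[of _ ?S] exI[of _ a]) auto
qed (use trace_basis_independent[OF B T] in blast)

end

subsection \<open>The quotient algebra\<close>

locale quotient_algebra = ideal I "class_ring :: 'n mpoly ring" for I :: "'n mpoly set"
begin

abbreviation res :: "'n mpoly \<Rightarrow> 'n mpoly set" where "res \<equiv> residue_class I"

lemma residue_class_altdef: "res p = (\<lambda>i. i + p) ` I"
  by (auto simp: residue_class_def a_r_coset_def r_coset_def)

lemma mem_zero: "0 \<in> I" and mem_add: "p \<in> I \<Longrightarrow> q \<in> I \<Longrightarrow> p + q \<in> I"
  and mem_mult: "p \<in> I \<Longrightarrow> q * p \<in> I"
  using additive_subgroup.zero_closed[OF additive_subgroup_axioms]
    additive_subgroup.a_closed[OF additive_subgroup_axioms, of p q]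
    I_l_closed[of p q] by simp_all

lemma mem_uminus: "p \<in> I \<Longrightarrow> - p \<in> I"
  using mem_mult[of p "-1"] by simp

lemma mem_diff: "p \<in> I \<Longrightarrow> q \<in> I \<Longrightarrow> p - q \<in> I"
  using mem_add[of p "- q"] mem_uminus[of q] by simp

lemma res_eq_iff: "res p = res q \<longleftrightarrow> p - q \<in> I"
proof
  assume "res p = res q"
  then have "p \<in> (\<lambda>i. i + q) ` I"
    using mem_zero unfolding residue_class_altdef by force
  then show "p - q \<in> I" by auto
next
  assume d: "p - q \<in> I"
  have "i + p \<in> (\<lambda>i. i + q) ` I" "i + q \<in> (\<lambda>i. i + p) ` I" if "i \<in> I" for i
  proof -
    have "i + p = (i + (p - q)) + q" "i + q = (i - (p - q)) + p" by simp_all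
    then show "i + p \<in> (\<lambda>i. i + q) ` I" "i + q \<in> (\<lambda>i. i + p) ` I"
      using that d mem_add mem_diff by blast+
  qed
  then show "res p = res q" unfolding residue_class_altdef by auto
qed

lemma carrier_quot_alg: "carrier (quot_alg I) = range res"
  by (auto simp: quot_alg_def Let_def FactRing_def A_RCOSETS_def RCOSETS_def
      residue_class_def a_r_coset_def)

lemma res_closed [simp]: "res p \<in> carrier (quot_alg I)"
  by (simp add: carrier_quot_alg)

lemma add_res [simp]: "res p \<oplus>\<^bsub>quot_alg I\<^esub> res q = res (p + q)"
  using a_rcos_sum[of p q] by (simp add: quot_alg_def Let_def FactRing_def residue_class_def)

lemma mult_res [simp]: "res p \<otimes>\<^bsub>quot_alg I\<^esub> res q = res (p * q)"
  using rcoset_mult_add[of p q] by (simp add: quot_alg_def Let_def FactRing_def residue_class_def)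

lemma zero_quot_alg: "\<zero>\<^bsub>quot_alg I\<^esub> = res 0"
  by (simp add: quot_alg_def Let_def FactRing_def residue_class_altdef)

lemma smult_res [simp]: "c \<odot>\<^bsub>quot_alg I\<^esub> res p = res (Const c * p)"
  using rcoset_mult_add[of "Const c" p]
  by (simp add: quot_alg_def Let_def FactRing_def residue_class_def)

lemma mult_map_res: "mult_map I h (res p) = res (h * p)"
  by (simp add: mult_map_def)

lemma vectorspace_quot_alg: "vectorspace class_ring (quot_alg I)"
proof (rule vs_criteria)
  show "\<forall>v\<in>carrier (quot_alg I). \<exists>w\<in>carrier (quot_alg I). v \<oplus>\<^bsub>quot_alg I\<^esub> w = \<zero>\<^bsub>quot_alg I\<^esub>"
  proof
    fix v assume "v \<in> carrier (quot_alg I)"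
    then obtain p where "v = res p" by (auto simp: carrier_quot_alg)
    then show "\<exists>w\<in>carrier (quot_alg I). v \<oplus>\<^bsub>quot_alg I\<^esub> w = \<zero>\<^bsub>quot_alg I\<^esub>"
      by (intro bexI[of _ "res (- p)"]) (simp_all add: zero_quot_alg)
  qed
qed (auto simp: carrier_quot_alg zero_quot_alg class_field single_add mult_single
    distrib_left distrib_right add_ac mult.assoc[symmetric])

end

subsection \<open>Certified matrices\<close>

lemma mon_degree_var_mon_add: "mon_degree (var_mon s + \<beta>) = Suc (mon_degree \<beta>)"
  by (simp add: mon_degree_def lookup_add lookup_single when_def sum.distrib)

lemma keys_mon_span:
  assumes "q \<in> mon_span B"
  shows "Poly_Mapping.keys q \<subseteq> B"
proof -
  obtain c where "q = (\<Sum>\<alpha>\<in>B. Poly_Mapping.single \<alpha> (c \<alpha>))"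
    using assms unfolding mon_span_def by (auto simp: mult_single)
  then show ?thesis
    using keys_sum[of "\<lambda>\<alpha>. Poly_Mapping.single \<alpha> (c \<alpha>)" B] by (auto split: if_splits)
qed

text \<open>Connectedness is applied to the single monomial \<alpha>. Since \<alpha> is not 1, the
  constant does not contribute to its coefficient, so some \<open>Var s * q s\<close> contains
  \<alpha>, and the cofactor of \<open>var_mon s\<close> is a key of \<open>q s\<close> and thus
  lies in \<open>B\<close>.\<close>

lemma connected_to_one_cases:
  assumes B: "connected_to_one B" and \<alpha>: "\<alpha> \<in> B" "\<alpha> \<noteq> 0"
  obtains s \<beta> where "\<beta> \<in> B" "\<alpha> = var_mon s + \<beta>"
proof -
  have fin: "finite B" using B unfolding connected_to_one_def by simp
  have "(\<Sum>\<beta>\<in>B. Const (if \<beta> = \<alpha> then 1 else 0) * Mon \<beta>) =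
      (\<Sum>\<beta>\<in>B. if \<beta> = \<alpha> then Mon \<beta> else 0)"
    by (intro sum.cong) (auto simp: mult_single)
  then have "Mon \<alpha> = (\<Sum>\<beta>\<in>B. Const (if \<beta> = \<alpha> then 1 else 0) * Mon \<beta>)"
    using fin \<alpha>(1) by simp
  then have "Mon \<alpha> \<in> mon_span B"
    unfolding mon_span_def
    by (intro CollectI exI[of _ "\<lambda>\<beta>. if \<beta> = \<alpha> then 1 else 0"] conjI TrueI)
  then obtain c q where eq: "Mon \<alpha> = Const c + (\<Sum>s\<in>UNIV. Var s * q s)"
    and q: "\<And>s. q s \<in> mon_span B"
    using B unfolding connected_to_one_def by blast
  have "(\<Sum>s\<in>UNIV. Poly_Mapping.lookup (Var s * q s) \<alpha>) \<noteq> 0"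
    using arg_cong[OF eq, of "\<lambda>p. Poly_Mapping.lookup p \<alpha>"] \<alpha>(2)
    by (simp add: lookup_add lookup_sum lookup_single when_def)
  then obtain s where "Poly_Mapping.lookup (Var s * q s) \<alpha> \<noteq> 0"
    by (rule sum.not_neutral_contains_not_neutral)
  then have "\<alpha> \<in> Poly_Mapping.keys (Var s * q s)" by (simp add: in_keys_iff)
  then obtain \<beta> where "\<beta> \<in> Poly_Mapping.keys (q s)" "\<alpha> = var_mon s + \<beta>"
    using keys_mult[of "Var s" "q s"] by auto
  then show thesis using that keys_mon_span[OF q] by blast
qed

text \<open>What a successful run provides: \<open>H\<close> is invertible by the rank test of Step
  2, \<open>M_col\<close> comes from Step 3, commutation and \<open>root\<close> from Step 5, and
  \<open>H_trace\<close> from Step 6. The last two assumptions are the dimension bound.\<close>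

locale certified_matrices = commuting_matrices k M
  for k :: nat and M :: "'n::{finite,linorder} \<Rightarrow> rat mat" +
  fixes fs :: "'n mpoly list" and bs :: "'n mon list" and H :: "rat mat"
  assumes len: "length bs = k" and dist: "distinct bs" and connected: "connected_to_one (set bs)"
    and M_col: "\<lbrakk>i < k; j < k; var_mon s + bs ! i = bs ! j\<rbrakk> \<Longrightarrow> col (M s) i = unit_vec k j"
    and root: "f \<in> set fs \<Longrightarrow> eval_poly k M f = 0\<^sub>m k k"
    and H: "H \<in> carrier_mat k k" "det H \<noteq> 0"
    and H_trace: "\<lbrakk>i < k; j < k\<rbrakk> \<Longrightarrow> H $$ (i, j) = mat_trace (eval_mon k M (bs ! i + bs ! j))"
    and fin_dim: "vectorspace.fin_dim class_ring (quot_alg (poly_ideal fs))"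
    and dim_le: "vectorspace.dim class_ring (quot_alg (poly_ideal fs)) \<le> k"
begin

abbreviation I :: "'n mpoly set" where "I \<equiv> poly_ideal fs"

sublocale quotient_algebra I
  unfolding quotient_algebra_def poly_ideal_def
  by (rule ring.genideal_ideal[OF class_ring.ring_axioms]) simp

text \<open>The kernel of evaluation is an ideal containing the generators by \<open>root\<close>,
  hence contains the smallest such ideal.\<close>

lemma ev_ideal:
  assumes "p \<in> I"
  shows "ev p = 0\<^sub>m k k"
proof -
  have inv: "inv\<^bsub>add_monoid class_ring\<^esub> q = - q" for q :: "'n mpoly"
    unfolding a_inv_def[symmetric] by (simp only: class_ring_simps)
  have "ideal {p. ev p = 0\<^sub>m k k} class_ring"
  proof (rule idealI)
    show "subgroup {p. ev p = 0\<^sub>m k k} (add_monoid class_ring)"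
      unfolding subgroup_def inv by (auto simp: ev_zero ev_add ev_uminus)
  qed (auto simp: ev_mult class_ring.ring_axioms)
  then have "I \<subseteq> {p. ev p = 0\<^sub>m k k}"
    unfolding poly_ideal_def using root by (intro ring.genideal_minimal[OF class_ring.ring_axioms]) auto
  then show ?thesis using assms by auto
qed

lemma ev_diff: "ev (p - q) = ev p - ev q"
  by (simp only: diff_conv_add_uminus ev_add ev_uminus) (rule eq_matI, auto)

lemma ev_res:
  assumes "res p = res q"
  shows "ev p = ev q"
proof -
  have "ev p = ev (p - q) + ev q" using ev_add[of "p - q" q] by simp
  also have "ev (p - q) = 0\<^sub>m k k" using assms by (intro ev_ideal) (simp add: res_eq_iff)
  finally show ?thesis by simp
qed

section \<open>Coordinates on the quotient algebra\<close>

definition one_index :: nat where "one_index = (SOME i. i < k \<and> bs ! i = 0)"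

lemma one_index: "one_index < k" "bs ! one_index = 0"
proof -
  have "\<exists>i<k. bs ! i = 0"
    using connected len unfolding connected_to_one_def in_set_conv_nth by auto
  from someI_ex[OF this] show "one_index < k" "bs ! one_index = 0"
    unfolding one_index_def by auto
qed

text \<open>Let e be the unit vector at \<open>one_index\<close>. By induction on the degree, if
  \<open>bs ! j\<close> is \<open>var_mon s\<close> times \<open>bs ! l\<close>, then
  \<open>bs ! l\<close> evaluated at \<open>M\<close> sends e to the unit vector \<open>l\<close>,
  and \<open>M s\<close> sends that to the unit vector \<open>j\<close> by
  \<open>M_col\<close>.\<close>

lemma eval_mon_col:
  assumes "i < k" "j < k"
  shows "eval_mon k M (bs ! j) $$ (i, one_index) = (if i = j then 1 else 0)"
  using assms
proof (induction "mon_degree (bs ! j)" arbitrary: i j rule: less_induct)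
  case less
  show ?case
  proof (cases "bs ! j = 0")
    case True
    then have "j = one_index"
      using one_index less.prems(2) nth_eq_iff_index_eq[OF dist, of j one_index] len by simp
    then show ?thesis using True less.prems by (simp add: eval_mon_zero)
  next
    case False
    have "bs ! j \<in> set bs" using less.prems len by simp
    then obtain s \<beta> where "\<beta> \<in> set bs" and \<beta>: "bs ! j = var_mon s + \<beta>"
      using connected_to_one_cases[OF connected _ False] by metis
    then obtain l where l: "l < k" "\<beta> = bs ! l"
      using len by (metis in_set_conv_nth)
    have "mon_degree (bs ! l) < mon_degree (bs ! j)"
      unfolding \<beta> l(2) mon_degree_var_mon_add by simp
    then have IH: "eval_mon k M (bs ! l) $$ (m, one_index) = (if m = l then 1 else 0)" if "m < k" for m
      using less.hyps[of l m] l(1) that by simp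
    have "eval_mon k M (bs ! j) = M s * eval_mon k M (bs ! l)"
      unfolding \<beta> l(2) eval_mon_add eval_mon_var_mon ..
    then have "eval_mon k M (bs ! j) $$ (i, one_index) =
        (\<Sum>m<k. M s $$ (i, m) * eval_mon k M (bs ! l) $$ (m, one_index))"
      using less.prems one_index carrier_matD[OF eval_mon_carrier] carrier_matD[OF M_carrier]
      by (auto simp: scalar_prod_def lessThan_atLeast0 intro!: sum.cong)
    also have "\<dots> = (\<Sum>m<k. if m = l then M s $$ (i, m) else 0)"
      by (intro sum.cong) (auto simp: IH)
    also have "\<dots> = col (M s) l $ i"
      using l less.prems carrier_matD[OF M_carrier] by simp
    also have "\<dots> = (if i = j then 1 else 0)"
      using less.prems unfolding M_col[OF l(1) less.prems(2) \<beta>[unfolded l(2), symmetric]] by simp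
    finally show ?thesis .
  qed
qed

text \<open>The coordinate vector of the class of \<open>p\<close> is p(M) e; by
  \<open>ev_res\<close> the chosen representative does not matter.\<close>

definition coord :: "'n mpoly set \<Rightarrow> nat \<Rightarrow> rat" where
  "coord u i = ev (SOME p. res p = u) $$ (i, one_index)"

lemma coord_res: "coord (res p) i = ev p $$ (i, one_index)"
proof -
  have "res (SOME q. res q = res p) = res p" by (rule someI) (rule refl)
  then show ?thesis unfolding coord_def using ev_res by metis
qed

lemma ev_mult_index:
  assumes "i < k" "j < k"
  shows "ev (p * q) $$ (i, j) = (\<Sum>l<k. ev p $$ (i, l) * ev q $$ (l, j))"
  using assms by (auto simp: ev_mult scalar_prod_def lessThan_atLeast0 intro!: sum.cong)

text \<open>The unit vector \<open>j\<close> is \<open>bs ! j\<close> evaluated at \<open>M\<close>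
  and applied to e, so column \<open>j\<close> of p(M) is the coordinate vector of the class of
  \<open>p * Mon (bs ! j)\<close>.\<close>

lemma ev_index:
  assumes "i < k" "j < k"
  shows "ev p $$ (i, j) = ev (p * Mon (bs ! j)) $$ (i, one_index)"
proof -
  have "ev (p * Mon (bs ! j)) $$ (i, one_index) = (\<Sum>l<k. if l = j then ev p $$ (i, l) else 0)"
    unfolding ev_mult_index[OF assms(1) one_index(1)]
    using assms by (intro sum.cong) (auto simp: ev_Mon eval_mon_col)
  then show ?thesis using assms by simp
qed

sublocale coordinates "quot_alg I" k coord "\<lambda>i. res (Mon (bs ! i))"
proof (intro coordinates.intro coordinates_axioms.intro vectorspace_quot_alg)
  fix c u v i assume "u \<in> carrier (quot_alg I)" "v \<in> carrier (quot_alg I)" and i: "i < k"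
  then obtain p q where "u = res p" "v = res q" by (auto simp: carrier_quot_alg)
  then show "coord (u \<oplus>\<^bsub>quot_alg I\<^esub> v) i = coord u i + coord v i"
    using i one_index by (simp add: coord_res ev_add)
next
  fix c v i assume "v \<in> carrier (quot_alg I)" and i: "i < k"
  then obtain p where "v = res p" by (auto simp: carrier_quot_alg)
  moreover have "ev (Const c * p) $$ (i, one_index) = (\<Sum>l<k. if l = i then c * ev p $$ (l, one_index) else 0)"
    unfolding ev_mult_index[OF i one_index(1)]
    using i by (intro sum.cong) (auto simp: ev_single eval_mon_zero)
  ultimately show "coord (c \<odot>\<^bsub>quot_alg I\<^esub> v) i = c * coord v i"
    using i by (simp add: coord_res)
qed (auto simp: coord_res ev_Mon eval_mon_col)

lemma basis_monomials: "basis ((\<lambda>i. res (Mon (bs ! i))) ` {..<k})"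
  by (rule b_basis[OF fin_dim dim_le])

text \<open>Multiplication by \<open>h\<close> turns the coordinate vector p(M) e into h(M) p(M) e,
  so its matrix is \<open>ev h\<close>.\<close>

lemma endo_trace_mult_map: "endo_trace (quot_alg I) (mult_map I h) = mat_trace (ev h)"
proof -
  have "endo_trace (quot_alg I) (mult_map I h) = (\<Sum>i<k. ev h $$ (i, i))"
    by (rule endo_trace_eq[OF basis_monomials, where N = "\<lambda>i j. ev h $$ (i, j)"])
      (auto simp: carrier_quot_alg mult_map_res coord_res ev_mult_index one_index)
  then show ?thesis by (simp add: mat_trace_def)
qed

text \<open>The ideal is the annihilator of e: the monomials form a basis, so a class with zero
  coordinates is zero.\<close>

lemma mem_ideal_iff: "p \<in> I \<longleftrightarrow> (\<forall>i<k. ev p $$ (i, one_index) = 0)"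
proof
  assume "p \<in> I"
  then show "\<forall>i<k. ev p $$ (i, one_index) = 0" using one_index by (simp add: ev_ideal)
next
  assume "\<forall>i<k. ev p $$ (i, one_index) = 0"
  then have "res p = res 0"
    using one_index by (intro coord_eqI[OF basis_monomials]) (auto simp: coord_res ev_zero)
  then show "p \<in> I" by (simp add: res_eq_iff)
qed

section \<open>The trace form, radicality and Hermite matrices\<close>

lemma mat_trace_ev_sum: "mat_trace (ev (sum f A)) = (\<Sum>a\<in>A. mat_trace (ev (f a)))"
  by (simp add: mat_trace_def ev_sum sum.swap[of _ A])

lemma mat_trace_ev_Const_mult: "mat_trace (ev (Const c * p)) = c * mat_trace (ev p)"
proof -
  have "ev (Const c * p) $$ (i, j) = c * ev p $$ (i, j)" if "i < k" "j < k" for i j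
  proof -
    have "ev (Const c * p) $$ (i, j) = (\<Sum>l<k. if l = i then c * ev p $$ (l, j) else 0)"
      unfolding ev_mult_index[OF that]
      using that by (intro sum.cong) (auto simp: ev_single eval_mon_zero)
    then show ?thesis using that by simp
  qed
  then show ?thesis by (simp add: mat_trace_def sum_distrib_left)
qed

text \<open>The trace depends only on the class of \<open>p\<close>, so \<open>p\<close> may be
  replaced by its normal form in the span of the monomials and linearity applies.\<close>

lemma mat_trace_ev_mult:
  "mat_trace (ev (q * p)) =
    (\<Sum>l<k. ev p $$ (l, one_index) * mat_trace (ev (q * Mon (bs ! l))))"
proof -
  \<comment> \<open>The normal form of \<open>p\<close>: its coefficients are the coordinates of the
    class of \<open>p\<close>.\<close>
  define p' where "p' = (\<Sum>l<k. Const (ev p $$ (l, one_index)) * Mon (bs ! l))"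
  have "ev p' $$ (i, one_index) = ev p $$ (i, one_index)" if "i < k" for i
  proof -
    have "ev p' $$ (i, one_index) =
        (\<Sum>l<k. ev p $$ (l, one_index) * (if i = l then 1 else 0))"
      unfolding p'_def using that one_index
      by (simp add: ev_sum mult_single ev_single eval_mon_col)
    also have "\<dots> = (\<Sum>l<k. if l = i then ev p $$ (l, one_index) else 0)"
      by (intro sum.cong) auto
    finally show ?thesis using that by simp
  qed
  then have "p - p' \<in> I"
    using one_index by (simp add: mem_ideal_iff ev_diff)
  then have "res (q * p) = res (q * p')"
    using mem_mult[of "p - p'" q] by (simp add: res_eq_iff right_diff_distrib)
  then have "mat_trace (ev (q * p)) = mat_trace (ev (q * p'))"
    by (metis ev_res)
  also have "q * p' = (\<Sum>l<k. Const (ev p $$ (l, one_index)) * (q * Mon (bs ! l)))"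
    by (simp add: p'_def sum_distrib_left mult.left_commute)
  finally show ?thesis
    by (simp add: mat_trace_ev_sum mat_trace_ev_Const_mult)
qed

lemma H_index: "\<lbrakk>i < k; j < k\<rbrakk> \<Longrightarrow> H $$ (i, j) = mat_trace (ev (Mon (bs ! i) * Mon (bs ! j)))"
  by (simp add: H_trace mult_single ev_Mon)

text \<open>If \<open>p\<close> is nilpotent modulo the ideal, so is each
  \<open>Mon (bs ! i) * p\<close>, whose evaluation then has trace 0. These traces are the entries
  of \<open>H\<close> times the coordinate vector of \<open>p\<close>, so that vector is 0 because
  \<open>H\<close> is invertible.\<close>

lemma radical_ideal: "radical I = I"
proof
  show "I \<subseteq> radical I"
    unfolding radical_def by (auto intro!: exI[of _ "1::nat"])
  show "radical I \<subseteq> I"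
  proof
    fix p assume "p \<in> radical I"
    then obtain r where r: "p ^ r \<in> I" unfolding radical_def by blast
    define v where "v = vec k (\<lambda>l. ev p $$ (l, one_index))"
    have "H *\<^sub>v v = 0\<^sub>v k"
    proof (rule eq_vecI)
      fix i assume "i < dim_vec (0\<^sub>v k :: rat vec)"
      then have i: "i < k" by simp
      have "(Mon (bs ! i) * p) ^ r \<in> I"
        using mem_mult[OF r] by (simp add: power_mult_distrib)
      then have "mat_trace (ev (Mon (bs ! i) * p)) = 0"
        using ev_ideal by (intro mat_trace_nilpotent[of _ k r]) (auto simp: ev_power[symmetric])
      moreover have "(H *\<^sub>v v) $ i =
          (\<Sum>l<k. ev p $$ (l, one_index) * mat_trace (ev (Mon (bs ! i) * Mon (bs ! l))))"
        using i H(1)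
        by (auto simp: v_def scalar_prod_def lessThan_atLeast0 H_index intro!: sum.cong)
      ultimately show "(H *\<^sub>v v) $ i = 0\<^sub>v k $ i"
        using i mat_trace_ev_mult[of "Mon (bs ! i)" p] by simp
    qed (use H(1) in auto)
    moreover have "v \<in> carrier_vec k" by (simp add: v_def)
    ultimately have "v = 0\<^sub>v k"
      using det_0_iff_vec_prod_zero_field[OF H(1)] H(2) by blast
    then show "p \<in> I"
      unfolding mem_ideal_iff v_def by (metis index_vec index_zero_vec(1))
  qed
qed

text \<open>Entry (i, j) is the trace form of \<open>bs ! i\<close> with
  \<open>g * Mon (bs ! j)\<close>. The coordinates of the latter are column \<open>j\<close> of
  \<open>ev g\<close>, and pairing with the basis monomials gives row \<open>i\<close> of
  \<open>H\<close>.\<close>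

lemma hermite_matrix_eq: "H * ev g = hermite_matrix I bs g"
proof (rule eq_matI)
  fix i j assume "i < dim_row (hermite_matrix I bs g)" "j < dim_col (hermite_matrix I bs g)"
  then have ij: "i < k" "j < k" by (auto simp: hermite_matrix_def len)
  have eq: "g * Mon (bs ! i + bs ! j) = Mon (bs ! i) * (g * Mon (bs ! j))"
    by (simp add: mult.left_commute mult_single)
  have "hermite_matrix I bs g $$ (i, j) = mat_trace (ev (Mon (bs ! i) * (g * Mon (bs ! j))))"
    using ij by (simp add: hermite_matrix_def len endo_trace_mult_map eq)
  also have "\<dots> = (\<Sum>l<k. H $$ (i, l) * ev g $$ (l, j))"
    unfolding mat_trace_ev_mult[of "Mon (bs ! i)" "g * Mon (bs ! j)"] using ij
    by (intro sum.cong) (auto simp: H_index ev_index[of _ j g])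
  also have "\<dots> = (H * ev g) $$ (i, j)"
    using ij H(1) by (auto simp: scalar_prod_def lessThan_atLeast0 intro!: sum.cong)
  finally show "(H * ev g) $$ (i, j) = hermite_matrix I bs g $$ (i, j)" by simp
qed (use H(1) in \<open>auto simp: hermite_matrix_def len\<close>)

end

section \<open>From a successful run to certified matrices\<close>

lemma if_None_else_SomeD: "(if c then None else x) = Some y \<Longrightarrow> \<not> c \<and> x = Some y"
  by (simp split: if_splits)

theorem theorem4p2:
  fixes fs :: "'n::{finite,linorder} mpoly list" and g :: "'n mpoly"
    and bs es :: "'n mon list" and k l :: nat
    and H1plus H1 Hg :: "rat mat" and ch :: "'n coeff_choice"
  assumes "distinct bs" and "length bs = k" and "connected_to_one (set bs)"
    and "distinct es" and "set es = extension (set bs)" and "length es = l"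
    and "H1plus \<in> carrier_mat l l"
    and "vectorspace.fin_dim class_ring (quot_alg (poly_ideal fs))"
    and "vectorspace.dim class_ring (quot_alg (poly_ideal fs)) \<le> k"
    and "hermite_certification ch fs g bs es H1plus = Some (H1, Hg)"
  shows "radical (poly_ideal fs) = poly_ideal fs
    \<and> inj_on (\<lambda>b. residue_class (poly_ideal fs) (Mon b)) (set bs)
    \<and> vectorspace.basis class_ring (quot_alg (poly_ideal fs))
        ((\<lambda>b. residue_class (poly_ideal fs) (Mon b)) ` set bs)
    \<and> H1 = hermite_matrix (poly_ideal fs) bs 1
    \<and> Hg = hermite_matrix (poly_ideal fs) bs g"
proof -
  define H where "H = submatrix_at es H1plus bs bs"
  define M where "M = (\<lambda>s. the (mat_inverse H) *
    submatrix_at es H1plus bs (map (\<lambda>\<alpha>. var_mon s + \<alpha>) bs))"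
  \<comment> \<open>Each fact holds the passed test of the step in its name as first conjunct and
    the remaining computation as second; the second conjunct of \<open>step6\<close> is the
    output.\<close>
  note step2 = if_None_else_SomeD[OF assms(10)[unfolded hermite_certification_def Let_def assms(2)]]
  note step3 = if_None_else_SomeD[OF conjunct2[OF step2]]
  note step4 = if_None_else_SomeD[OF conjunct2[OF step3]]
  note step5 = if_None_else_SomeD[OF conjunct2[OF step4]]
  note step6 = if_None_else_SomeD[OF conjunct2[OF step5]]
  have rank: "vec_space.rank k H = k"
    unfolding H_def using step2 by blast
  have col: "col (M s) i = unit_vec k j" if "i < k" "j < k" "var_mon s + bs ! i = bs ! j" for s i j
    unfolding M_def H_def using step3 that by blast
  have comm: "M s * M t = M t * M s" if "s < t" for s t
    unfolding M_def H_def using step5 that by blast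
  have root: "eval_poly k M f = 0\<^sub>m k k" if "f \<in> set fs" for f
    unfolding M_def H_def using step5 that by blast
  have trace: "H $$ (i, j) = mat_trace (eval_mon k M (bs ! i + bs ! j))" if "i < k" "j < k" for i j
    unfolding M_def H_def using step6 that by metis
  have out: "H1 = H" "Hg = H * eval_poly k M g"
    unfolding M_def H_def using step6 by blast+
  have H: "H \<in> carrier_mat k k"
    using assms(2) by (simp add: H_def submatrix_at_def)
  have det: "det H \<noteq> 0" using vec_space.det_rank_iff[OF H] rank by blast
  \<comment> \<open>Invertibility makes \<open>mat_inverse\<close> return a matrix, so
    \<open>the\<close> in the definition of \<open>M\<close> yields a genuine inverse.\<close>
  have "H \<in> Units (ring_mat TYPE(rat) k ())"
    by (rule det_non_zero_imp_unit[OF H det])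
  then obtain H' where H': "mat_inverse H = Some H'"
    using mat_inverse(1)[OF H, where b = "()"] by (cases "mat_inverse H") auto
  have M_carrier: "M s \<in> carrier_mat k k" for s
    using mat_inverse(2)[OF H H'] assms(2)
    by (simp add: M_def H' submatrix_at_def mult_carrier_mat[of _ k k])
  \<comment> \<open>The algorithm tests only pairs with \<open>s < t\<close>; the linear order of
    the variables covers the rest.\<close>
  have "M s * M t = M t * M s" for s t
    using comm[of s t] comm[of t s] linorder_less_linear[of s t] by auto
  then interpret certified_matrices k M fs bs H
    using assms H det M_carrier col root trace by unfold_locales auto
  have nth: "set bs = (\<lambda>i. bs ! i) ` {..<k}"
    using len by (auto simp: in_set_conv_nth)
  have "inj_on (\<lambda>b. res (Mon b)) (set bs)"
    unfolding nth by (rule inj_on_imageI) (use b_inj in \<open>simp add: o_def\<close>)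
  moreover have "basis ((\<lambda>b. res (Mon b)) ` set bs)"
    using basis_monomials by (simp add: nth image_image)
  \<comment> \<open>This is the case \<open>g = 1\<close>, since 1 evaluates to the identity
    matrix.\<close>
  moreover have "H = hermite_matrix I bs 1"
    using hermite_matrix_eq[of 1] right_mult_one_mat[OF H(1)] by (simp add: ev_one)
  ultimately show ?thesis
    using radical_ideal hermite_matrix_eq[of g] out by simp
qed

end
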